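(* Let $\mathscr{A} \in \mathbb{E}$ be such that, for some real numbers $\alpha_1,\dots,\alpha_7$ and real $3\times 3$ matrices $\mathbf{U}_1,\dots,\mathbf{U}_7$, $$\mathscr{A}\mathbf{y}^2 = \sum_{s=1}^7 \alpha_s (\mathbf{U}_s\mathbf{y})(\mathbf{U}_s\mathbf{y})^\top \quad \text{for all } \mathbf{y} \in \mathbb{R}^3,$$ where (i) $\alpha_1,\dots,\alpha_6 > 0$ and $\alpha_7 < 0$; (ii) $\mathbf{U}_s = \mathbf{v}_s\mathbf{w}_s^\top$ with $\mathbf{v}_s,\mathbf{w}_s \in \mathbb{R}^3$ for $s = 1,2,\dots,6$, and $\mathbf{v}_s = \mathbf{v}_{s+3}$ for $s = 1,2,3$; (iii) the matrices $\mathbf{V} = [\mathbf{v}_1,\mathbf{v}_2,\mathbf{v}_3]$, $\mathbf{W} = [\mathbf{w}_1,\mathbf{w}_2,\mathbf{w}_3]$ and $\widetilde{\mathbf{W}} = [\mathbf{w}_4,\mathbf{w}_5,\mathbf{w}_6]$ are nonsingular; (iv) $\mathbf{w}_s$ and $\mathbf{w}_{s+3}$ are linearly independent for $s = 1,2,3$. Then $\mathscr{A}$ is M-PSD if and only if there exist real numbers $\sigma_1,\dots,\sigma_6$ such that (i) $\mathbf{U}_7 = \mathbf{V}\boldsymbol{\Sigma}_7\mathbf{W}^\top + \mathbf{V}\widetilde{\boldsymbol{\Sigma}}_7\widetilde{\mathbf{W}}^\top$ with $\boldsymbol{\Sigma}_7 = \mathrm{diag}(\sigma_1,\sigma_2,\sigma_3)$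 and $\widetilde{\boldsymbol{\Sigma}}_7 = \mathrm{diag}(\sigma_4,\sigma_5,\sigma_6)$; and (ii) $\displaystyle \sup\Big\{\eta(\mathbf{y}) : \mathbf{y} \in \mathbb{R}^3,\ \mathbf{y} \notin \bigcup_{s=1,2,3}\big(\mathbf{w}_s^\bot \cap \mathbf{w}_{s+3}^\bot\big)\Big\} \leq \frac{1}{-\alpha_7}$, where $$\eta(\mathbf{y}) := \sum_{s=1}^3 \frac{(\sigma_s\mathbf{w}_s^\top\mathbf{y} + \sigma_{s+3}\mathbf{w}_{s+3}^\top\mathbf{y})^2}{\alpha_s(\mathbf{w}_s^\top\mathbf{y})^2 + \alpha_{s+3}(\mathbf{w}_{s+3}^\top\mathbf{y})^2}.$$
   Context: $\mathbb{E}$ denotes the set of all real fourth-order three-dimensional tensors $\mathscr{A} = (a_{ijkl}) \in \mathbb{R}^{3\times 3\times 3\times 3}$ such that $a_{ijkl} = a_{jikl} = a_{ijlk}$ for all $i,j,k,l \in \{1,2,3\}$. For $\mathbf{y} \in \mathbb{R}^3$, $\mathscr{A}\mathbf{y}^2$ is the symmetric $3\times 3$ matrix with entries $(\mathscr{A}\mathbf{y}^2)_{ij} := \sum_{k,l=1}^3 a_{ijkl}y_ky_l$. The tensor $\mathscr{A}$ is M-positive semidefinite (M-PSD) if $\mathscr{A}\mathbf{x}^2\mathbf{y}^2 := \sum_{i,j,k,l=1}^3 a_{ijkl}x_ix_jy_ky_l \geq 0$ for all $\mathbf{x},\mathbf{y} \in \mathbb{R}^3$. For $\mathbf{w} \in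 \mathbb{R}^3$, $\mathbf{w}^\bot$ denotes the orthogonal complement of $\mathrm{span}(\mathbf{w})$ in $\mathbb{R}^3$. *)

theory Defs
  imports "HOL-Analysis.Analysis"
begin

text \<open>The entry \<open>a\<^sub>i\<^sub>j\<^sub>k\<^sub>l\<close> of a fourth-order tensor is \<open>A $ i $ j $ k $ l\<close>.\<close>

type_synonym tensor4 = "real^3^3^3^3"

definition tensor_E :: "tensor4 set" where
  "tensor_E = {A. \<forall>i j k l. A $ i $ j $ k $ l = A $ j $ i $ k $ l \<and> A $ i $ j $ k $ l = A $ i $ j $ l $ k}"

definition tensor_y2 :: "tensor4 \<Rightarrow> real^3 \<Rightarrow> real^3^3" where
  "tensor_y2 A y = (\<chi> i j. \<Sum>k\<in>UNIV. \<Sum>l\<in>UNIV. A $ i $ j $ k $ l * y $ k * y $ l)"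

definition tensor_x2y2 :: "tensor4 \<Rightarrow> real^3 \<Rightarrow> real^3 \<Rightarrow> real" where
  "tensor_x2y2 A x y =
     (\<Sum>i\<in>UNIV. \<Sum>j\<in>UNIV. \<Sum>k\<in>UNIV. \<Sum>l\<in>UNIV. A $ i $ j $ k $ l * x $ i * x $ j * y $ k * y $ l)"

definition M_PSD :: "tensor4 \<Rightarrow> bool" where
  "M_PSD A \<longleftrightarrow> (\<forall>x y. tensor_x2y2 A x y \<ge> 0)"

text \<open>The matrix \<open>x y\<^sup>T\<close>, as a product of a one-column and a one-row matrix.\<close>

definition outer :: "real^3 \<Rightarrow> real^3 \<Rightarrow> real^3^3" where
  "outer x y = (columnvector x :: real^1^3) ** (rowvector y :: real^3^1)"

text \<open>\<^const>\<open>vector\<close> lists the rows of a matrix; the transpose makes the arguments columns.\<close>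

definition cols3 :: "real^3 \<Rightarrow> real^3 \<Rightarrow> real^3 \<Rightarrow> real^3^3" where
  "cols3 a b c = transpose (vector [a, b, c])"

definition diag3 :: "real \<Rightarrow> real \<Rightarrow> real \<Rightarrow> real^3^3" where
  "diag3 a b c = (\<chi> i j. if i = j then (vector [a, b, c] :: real^3) $ i else 0)"

text \<open>Equal vectors are dependent, although the set \<open>{a, a}\<close> is independent when \<open>a \<noteq> 0\<close>.\<close>

definition lin_indep2 :: "real^3 \<Rightarrow> real^3 \<Rightarrow> bool" where
  "lin_indep2 a b \<longleftrightarrow> a \<noteq> b \<and> independent {a, b}"

definition eta :: "(nat \<Rightarrow> real) \<Rightarrow> (nat \<Rightarrow> real^3) \<Rightarrow> (nat \<Rightarrow> real) \<Rightarrow> real^3 \<Rightarrow> real" where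
  "eta \<alpha> w \<sigma> y =
     (\<Sum>s=1..3. (\<sigma> s * (w s \<bullet> y) + \<sigma> (s + 3) * (w (s + 3) \<bullet> y))\<^sup>2
               / (\<alpha> s * (w s \<bullet> y)\<^sup>2 + \<alpha> (s + 3) * (w (s + 3) \<bullet> y)\<^sup>2))"

end

theory Submission
  imports Defs
begin

text \<open>
  Put \<open>q\<^sub>s(y) = \<alpha>\<^sub>s (w\<^sub>s \<bullet> y)\<^sup>2 + \<alpha>\<^sub>s\<^sub>+\<^sub>3 (w\<^sub>s\<^sub>+\<^sub>3 \<bullet> y)\<^sup>2\<close> and \<open>U\<^sub>7 y = \<Sum>\<^sub>s (c\<^sub>s \<bullet> y) v\<^sub>s\<close>. Since \<open>V\<close> is
  nonsingular, the numbers \<open>u\<^sub>s = v\<^sub>s \<bullet> x\<close> are arbitrary, so M-positive semidefiniteness says that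
  \<open>-\<alpha>\<^sub>7 (\<Sum>\<^sub>s u\<^sub>s (c\<^sub>s \<bullet> y))\<^sup>2 \<le> \<Sum>\<^sub>s u\<^sub>s\<^sup>2 q\<^sub>s(y)\<close> for all \<open>u\<close> and \<open>y\<close>. If this holds, then \<open>c\<^sub>s\<close>
  vanishes wherever \<open>w\<^sub>s\<close> and \<open>w\<^sub>s\<^sub>+\<^sub>3\<close> do, hence lies in their span, and \<open>u\<^sub>s = (c\<^sub>s \<bullet> y) / q\<^sub>s(y)\<close>
  gives the bound on \<open>\<eta>\<close>. Conversely, the bound on \<open>\<eta>\<close> gives the inequality by Cauchy-Schwarz
  wherever all \<open>q\<^sub>s(y)\<close> are positive; such \<open>y\<close> are dense.
\<close>

lemma outer_mult_vec: "outer a b *v y = (b \<bullet> y) *\<^sub>R a"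
  by (simp add: outer_def vec_eq_iff matrix_vector_mult_def matrix_matrix_mult_def
      columnvector_def rowvector_def inner_vec_def sum_3 algebra_simps)

lemma tensor_x2y2_eq_inner: "tensor_x2y2 A x y = x \<bullet> (tensor_y2 A y *v x)"
  by (simp add: tensor_x2y2_def tensor_y2_def matrix_vector_mult_def inner_vec_def
      sum_distrib_left sum_distrib_right mult_ac)

lemma sum_matrix_vector_mult:
  fixes M :: "'i \<Rightarrow> real^'n^'m"
  shows "(\<Sum>i\<in>I. M i) *v x = (\<Sum>i\<in>I. M i *v x)"
  by (induction I rule: infinite_finite_induct) (auto simp: matrix_vector_mult_add_rdistrib)

lemma cols3_mult_vec: "cols3 a b c *v z = z $ 1 *\<^sub>R a + z $ 2 *\<^sub>R b + z $ 3 *\<^sub>R c"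
  by (simp add: cols3_def vec_eq_iff matrix_vector_mult_def sum_3 transpose_def algebra_simps)

lemma transpose_cols3_mult_vec: "transpose (cols3 a b c) *v x = vector [a \<bullet> x, b \<bullet> x, c \<bullet> x]"
  by (simp add: cols3_def vec_eq_iff forall_3 matrix_vector_mult_def inner_vec_def transpose_transpose)

lemma diag3_mult_vec: "diag3 a b c *v z = vector [a * z $ 1, b * z $ 2, c * z $ 3]"
  by (simp add: diag3_def vec_eq_iff forall_3 matrix_vector_mult_def sum_3)

lemma cols3_diag3_cols3_mult_vec:
  "(cols3 a b c ** diag3 p q r ** transpose (cols3 d e f)) *v y
     = (p * (d \<bullet> y)) *\<^sub>R a + (q * (e \<bullet> y)) *\<^sub>R b + (r * (f \<bullet> y)) *\<^sub>R c"
  by (simp add: matrix_vector_mul_assoc [symmetric] transpose_cols3_mult_vec diag3_mult_vec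
      cols3_mult_vec del: matrix_vector_mul_assoc transpose_matrix_vector)

text \<open>The inner products are the entries of the transposed matrix applied to x, and that
  transpose is invertible too. Applied to \<open>v\<close> it realizes arbitrary coefficients;
  applied to \<open>w\<close> it yields a direction of perturbation.\<close>

lemma invertible_cols3_inner_surj:
  fixes v :: "nat \<Rightarrow> real^3" and u :: "nat \<Rightarrow> real"
  assumes "invertible (cols3 (v 1) (v 2) (v 3))"
  shows "\<exists>x. \<forall>s\<in>{1..3}. v s \<bullet> x = u s"
proof -
  let ?T = "transpose (cols3 (v 1) (v 2) (v 3))"
  have "invertible ?T"
    using assms by (simp add: invertible_det_nz)
  then obtain B where "?T ** B = mat 1"
    by (auto simp: invertible_def)
  then have "?T *v (B *v vector [u 1, u 2, u 3]) = vector [u 1, u 2, u 3]"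
    by (simp add: matrix_vector_mul_assoc)
  then have "\<exists>x. v 1 \<bullet> x = u 1 \<and> v 2 \<bullet> x = u 2 \<and> v 3 \<bullet> x = u 3"
    unfolding transpose_cols3_mult_vec vec_eq_iff forall_3 by auto
  moreover have "{1..3} = {1, 2, 3::nat}"
    by auto
  ultimately show ?thesis
    by simp
qed

lemma mem_orthogonal_comp_span_singleton:
  "y \<in> orthogonal_comp (span {a}) \<longleftrightarrow> a \<bullet> y = 0"
  by (auto simp: orthogonal_comp_def orthogonal_def span_singleton inner_commute
      dest: spec [of _ a] bspec [of _ _ "1 *\<^sub>R a"])

text \<open>The hypothesis places c in the double orthogonal complement of the span of a and b,
  which in finite dimension is the span itself.\<close>

lemma in_span_pair_if_annihilated:
  fixes a b c :: "'a::euclidean_space"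
  assumes "\<And>y. a \<bullet> y = 0 \<Longrightarrow> b \<bullet> y = 0 \<Longrightarrow> c \<bullet> y = 0"
  shows "\<exists>p r. c = p *\<^sub>R a + r *\<^sub>R b"
proof -
  have "c \<in> orthogonal_comp (orthogonal_comp (span {a, b}))"
    using assms
    by (auto simp: orthogonal_comp_def orthogonal_def span_base inner_commute)
  then have "c \<in> span {a, b}"
    by (simp add: orthogonal_comp_self)
  then obtain p r where "c - p *\<^sub>R a = r *\<^sub>R b"
    by (auto simp: span_breakdown_eq span_singleton)
  then show ?thesis
    by (metis add.commute diff_add_cancel)
qed

text \<open>Cauchy-Schwarz after splitting each product as
  \<open>(u s * sqrt (q s)) * (b s / sqrt (q s))\<close>.\<close>

lemma weighted_Cauchy_Schwarz_sum:
  fixes u b q :: "'i \<Rightarrow> real"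
  assumes "\<And>s. s \<in> S \<Longrightarrow> q s > 0"
  shows "(\<Sum>s\<in>S. u s * b s)\<^sup>2 \<le> (\<Sum>s\<in>S. (u s)\<^sup>2 * q s) * (\<Sum>s\<in>S. (b s)\<^sup>2 / q s)"
proof -
  have "(\<Sum>s\<in>S. u s * b s) = (\<Sum>s\<in>S. (u s * sqrt (q s)) * (b s / sqrt (q s)))"
    using assms by (intro sum.cong) fastforce+
  also have "\<dots>\<^sup>2 \<le> (\<Sum>s\<in>S. (u s * sqrt (q s))\<^sup>2) * (\<Sum>s\<in>S. (b s / sqrt (q s))\<^sup>2)"
    by (rule Cauchy_Schwarz_ineq_sum)
  also have "\<dots> = (\<Sum>s\<in>S. (u s)\<^sup>2 * q s) * (\<Sum>s\<in>S. (b s)\<^sup>2 / q s)"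
    using assms by (intro arg_cong2 [where f = "(*)"] sum.cong)
      (auto simp: power_mult_distrib power_divide less_imp_le)
  finally show ?thesis .
qed

theorem theorem4p2:
  fixes A :: tensor4
    and \<alpha> :: "nat \<Rightarrow> real"
    and U :: "nat \<Rightarrow> real^3^3"
    and v w :: "nat \<Rightarrow> real^3"
    and V W W' :: "real^3^3"
  assumes "A \<in> tensor_E"
    and "\<And>y. tensor_y2 A y = (\<Sum>s=1..7. \<alpha> s *\<^sub>R outer (U s *v y) (U s *v y))"
    and "\<And>s. s \<in> {1..6} \<Longrightarrow> \<alpha> s > 0" and "\<alpha> 7 < 0"
    and "\<And>s. s \<in> {1..6} \<Longrightarrow> U s = outer (v s) (w s)"
    and "\<And>s. s \<in> {1..3} \<Longrightarrow> v s = v (s + 3)"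
    and "V = cols3 (v 1) (v 2) (v 3)"
    and "W = cols3 (w 1) (w 2) (w 3)"
    and "W' = cols3 (w 4) (w 5) (w 6)"
    and "invertible V" and "invertible W" and "invertible W'"
    and "\<And>s. s \<in> {1..3} \<Longrightarrow> lin_indep2 (w s) (w (s + 3))"
  shows "M_PSD A \<longleftrightarrow>
    (\<exists>\<sigma> :: nat \<Rightarrow> real.
       U 7 = V ** diag3 (\<sigma> 1) (\<sigma> 2) (\<sigma> 3) ** transpose W
           + V ** diag3 (\<sigma> 4) (\<sigma> 5) (\<sigma> 6) ** transpose W' \<and>
       Sup {ereal (eta \<alpha> w \<sigma> y) | y.
              y \<notin> (\<Union>s\<in>{1..3}. orthogonal_comp (span {w s}) \<inter> orthogonal_comp (span {w (s + 3)}))}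
         \<le> ereal (1 / (- \<alpha> 7)))"
proof -
  define \<beta> where "\<beta> = - \<alpha> 7"
  define q where "q s y = \<alpha> s * (w s \<bullet> y)\<^sup>2 + \<alpha> (s + 3) * (w (s + 3) \<bullet> y)\<^sup>2" for s y
  \<comment> \<open>These y are exactly those over which the supremum is taken; there every
    denominator of \<eta> is positive.\<close>
  define good where "good y \<longleftrightarrow> (\<forall>s\<in>{1..3}. w s \<bullet> y \<noteq> 0 \<or> w (s + 3) \<bullet> y \<noteq> 0)" for y
  have \<beta>: "\<beta> > 0"
    using assms(4) by (simp add: \<beta>_def)
  have idx: "{1..3} = {1, 2, 3::nat}" "{1..7} = {1, 2, 3, 4, 5, 6, 7::nat}"
    by auto
  have q_pos: "q s y > 0" if "good y" "s \<in> {1..3}" for s y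
  proof -
    have "\<alpha> s > 0" "\<alpha> (s + 3) > 0"
      using that(2) by (auto intro!: assms(3))
    moreover have "w s \<bullet> y \<noteq> 0 \<or> w (s + 3) \<bullet> y \<noteq> 0"
      using that by (simp add: good_def)
    ultimately show ?thesis
      unfolding q_def by (auto intro: add_pos_nonneg add_nonneg_pos)
  qed
  \<comment> \<open>Because v is repeated with period 3, the terms s and s + 3 share the factor
    \<open>(v s \<bullet> x)\<^sup>2\<close> and merge into \<open>q s y\<close>; only the seventh
    term is negative.\<close>
  have form: "tensor_x2y2 A x y = (\<Sum>s=1..3. (v s \<bullet> x)\<^sup>2 * q s y) - \<beta> * (x \<bullet> (U 7 *v y))\<^sup>2" for x y
  proof -
    have v4: "v 4 = v 1" "v 5 = v 2" "v 6 = v 3"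
      using assms(6)[of 1] assms(6)[of 2] assms(6)[of 3] by simp_all
    have U: "U s *v y = (w s \<bullet> y) *\<^sub>R v s" if "s \<in> {1..6}" for s
      using that by (simp add: assms(5) outer_mult_vec)
    have "tensor_x2y2 A x y = (\<Sum>s=1..7. \<alpha> s * (x \<bullet> (U s *v y))\<^sup>2)"
      unfolding tensor_x2y2_eq_inner assms(2) sum_matrix_vector_mult
      by (simp add: inner_sum_right scaleR_matrix_vector_assoc [symmetric] outer_mult_vec
          power2_eq_square inner_commute mult.assoc)
    then show ?thesis
      unfolding idx by (simp add: U v4 q_def \<beta>_def inner_commute algebra_simps power2_eq_square)
  qed
  have eta_eq: "eta \<alpha> w \<sigma> y = (\<Sum>s=1..3. ((\<sigma> s *\<^sub>R w s + \<sigma> (s + 3) *\<^sub>R w (s + 3)) \<bullet> y)\<^sup>2 / q s y)"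
    for \<sigma> y
    by (simp add: eta_def q_def inner_add_left)
  have U7_iff: "U 7 = V ** diag3 (\<sigma> 1) (\<sigma> 2) (\<sigma> 3) ** transpose W
           + V ** diag3 (\<sigma> 4) (\<sigma> 5) (\<sigma> 6) ** transpose W' \<longleftrightarrow>
      (\<forall>y. U 7 *v y = (\<Sum>s=1..3. ((\<sigma> s *\<^sub>R w s + \<sigma> (s + 3) *\<^sub>R w (s + 3)) \<bullet> y) *\<^sub>R v s))" for \<sigma>
    unfolding matrix_eq assms(7-9) matrix_vector_mult_add_rdistrib cols3_diag3_cols3_mult_vec
    unfolding idx by (simp add: inner_add_left algebra_simps)
  \<comment> \<open>In the complete lattice \<open>ereal\<close>, a bound on the supremum is the
    same as a pointwise bound.\<close>
  have Sup_iff: "Sup {ereal (eta \<alpha> w \<sigma> y) | y.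
              y \<notin> (\<Union>s\<in>{1..3}. orthogonal_comp (span {w s}) \<inter> orthogonal_comp (span {w (s + 3)}))}
         \<le> ereal (1 / (- \<alpha> 7)) \<longleftrightarrow> (\<forall>y. good y \<longrightarrow> eta \<alpha> w \<sigma> y \<le> 1 / \<beta>)" for \<sigma>
    unfolding setcompr_eq_image SUP_le_iff
    by (simp add: mem_orthogonal_comp_span_singleton good_def \<beta>_def)
  show ?thesis
    unfolding U7_iff Sup_iff
  proof
    assume psd: "M_PSD A"
    from assms(10) obtain B where "V ** B = mat 1"
      by (auto simp: invertible_def)
    then have U7: "U 7 *v y = V *v ((B ** U 7) *v y)" for y
      by (simp add: matrix_vector_mul_assoc matrix_mul_assoc)
    \<comment> \<open>\<open>B\<close> inverts \<open>V\<close>, so the rows of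
      \<open>B ** U 7\<close> give the coordinates of \<open>U 7 *v y\<close> in the basis formed by
      the v's. In the index type \<open>3\<close> the number 3 equals 0, so \<open>of_nat\<close>
      still yields three distinct rows.\<close>
    define c where "c s = (B ** U 7) $ of_nat s" for s :: nat
    have U7c: "U 7 *v y = (\<Sum>s=1..3. (c s \<bullet> y) *\<^sub>R v s)" for y
      unfolding U7 assms(7) cols3_mult_vec
      unfolding idx by (simp add: c_def matrix_vector_mul_component algebra_simps)
    have ineq: "\<beta> * (\<Sum>s=1..3. u s * (c s \<bullet> y))\<^sup>2 \<le> (\<Sum>s=1..3. (u s)\<^sup>2 * q s y)" for u y
    proof -
      obtain x where x: "\<forall>s\<in>{1..3}. v s \<bullet> x = u s"
        using invertible_cols3_inner_surj[of v u] assms(7,10) by auto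
      have "0 \<le> tensor_x2y2 A x y"
        using psd by (simp add: M_PSD_def)
      also have "tensor_x2y2 A x y = (\<Sum>s=1..3. (u s)\<^sup>2 * q s y) - \<beta> * (\<Sum>s=1..3. u s * (c s \<bullet> y))\<^sup>2"
        using x unfolding form U7c idx by (simp add: inner_add_right inner_commute mult.commute)
      finally show ?thesis
        by simp
    qed
    have "\<exists>p r. c s = p *\<^sub>R w s + r *\<^sub>R w (s + 3)" if s: "s \<in> {1..3}" for s
    proof (rule in_span_pair_if_annihilated)
      fix y assume "w s \<bullet> y = 0" "w (s + 3) \<bullet> y = 0"
      then have "q s y = 0"
        by (simp add: q_def)
      \<comment> \<open>The s-th unit vector as u isolates the s-th term on both sides.\<close>
      with ineq[of "\<lambda>t. if t = s then 1 else 0" y] s have "\<beta> * (c s \<bullet> y)\<^sup>2 \<le> 0"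
        by (simp add: if_distrib [where f = "\<lambda>z. z * _"] if_distrib [where f = "\<lambda>z. z\<^sup>2"] cong: if_cong)
      with \<beta> show "c s \<bullet> y = 0"
        by (simp add: mult_le_0_iff)
    qed
    then obtain p r where pr: "\<And>s. s \<in> {1..3} \<Longrightarrow> c s = p s *\<^sub>R w s + r s *\<^sub>R w (s + 3)"
      by metis
    define \<sigma> where "\<sigma> s = (if s \<le> 3 then p s else r (s - 3))" for s :: nat
    have c_eq: "c s = \<sigma> s *\<^sub>R w s + \<sigma> (s + 3) *\<^sub>R w (s + 3)" if "s \<in> {1..3}" for s
      using pr[OF that] that by (simp add: \<sigma>_def)
    have "eta \<alpha> w \<sigma> y \<le> 1 / \<beta>" if "good y" for y
    proof -
      let ?e = "\<Sum>s=1..3. (c s \<bullet> y)\<^sup>2 / q s y"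
      have nz: "q s y > 0" if "s \<in> {1..3}" for s
        using q_pos \<open>good y\<close> that by blast
      \<comment> \<open>With this u, the sum inside the square on the left and the whole right-hand
        side of \<open>ineq\<close> both equal \<open>?e\<close>, leaving \<beta> e^2 \<le>
        e.\<close>
      have "\<beta> * ?e\<^sup>2 \<le> (\<Sum>s=1..3. ((c s \<bullet> y) / q s y)\<^sup>2 * q s y)"
        using ineq[of "\<lambda>s. (c s \<bullet> y) / q s y" y] by (simp add: power2_eq_square)
      also have "\<dots> = ?e"
        using nz by (intro sum.cong) (auto simp: power2_eq_square dest: less_imp_neq)
      finally have "?e * (\<beta> * ?e) \<le> ?e * 1"
        by (simp add: power2_eq_square mult_ac)
      moreover have "?e \<ge> 0"
        using nz by (intro sum_nonneg) (auto simp: less_imp_le)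
      \<comment> \<open>The factor \<open>?e\<close> cancels unless it is zero, when the bound is
        trivial.\<close>
      ultimately have "\<beta> * ?e \<le> 1"
        by (cases "?e = 0") (simp_all add: mult_le_cancel_left)
      moreover have "eta \<alpha> w \<sigma> y = ?e"
        unfolding eta_eq by (intro sum.cong) (simp_all add: c_eq)
      ultimately show ?thesis
        using \<beta> by (simp add: field_simps)
    qed
    moreover have "U 7 *v y = (\<Sum>s=1..3. ((\<sigma> s *\<^sub>R w s + \<sigma> (s + 3) *\<^sub>R w (s + 3)) \<bullet> y) *\<^sub>R v s)" for y
      unfolding U7c by (intro sum.cong) (simp_all add: c_eq)
    ultimately show "\<exists>\<sigma>. (\<forall>y. U 7 *v y = (\<Sum>s=1..3. ((\<sigma> s *\<^sub>R w s + \<sigma> (s + 3) *\<^sub>R w (s + 3)) \<bullet> y) *\<^sub>R v s)) \<and>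
        (\<forall>y. good y \<longrightarrow> eta \<alpha> w \<sigma> y \<le> 1 / \<beta>)"
      by blast
  next
    assume "\<exists>\<sigma>. (\<forall>y. U 7 *v y = (\<Sum>s=1..3. ((\<sigma> s *\<^sub>R w s + \<sigma> (s + 3) *\<^sub>R w (s + 3)) \<bullet> y) *\<^sub>R v s)) \<and>
        (\<forall>y. good y \<longrightarrow> eta \<alpha> w \<sigma> y \<le> 1 / \<beta>)"
    then obtain \<sigma> where
      U7: "\<And>y. U 7 *v y = (\<Sum>s=1..3. ((\<sigma> s *\<^sub>R w s + \<sigma> (s + 3) *\<^sub>R w (s + 3)) \<bullet> y) *\<^sub>R v s)" and
      eta_le: "\<And>y. good y \<Longrightarrow> eta \<alpha> w \<sigma> y \<le> 1 / \<beta>"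
      by blast
    have nonneg: "tensor_x2y2 A x y \<ge> 0" if "good y" for x y
    proof -
      let ?b = "\<lambda>s. (\<sigma> s *\<^sub>R w s + \<sigma> (s + 3) *\<^sub>R w (s + 3)) \<bullet> y"
      let ?Q = "\<Sum>s=1..3. (v s \<bullet> x)\<^sup>2 * q s y"
      have "x \<bullet> (U 7 *v y) = (\<Sum>s=1..3. (v s \<bullet> x) * ?b s)"
        unfolding U7 by (simp add: inner_sum_right inner_commute mult.commute)
      then have "(x \<bullet> (U 7 *v y))\<^sup>2 \<le> ?Q * eta \<alpha> w \<sigma> y"
        unfolding eta_eq using weighted_Cauchy_Schwarz_sum[of "{1..3}" "\<lambda>s. q s y"] q_pos[OF that]
        by simp
      also have "\<dots> \<le> ?Q * (1 / \<beta>)"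
        using q_pos[OF that] by (intro mult_left_mono eta_le that sum_nonneg) (auto simp: less_imp_le)
      finally show ?thesis
        using \<beta> by (simp add: form field_simps)
    qed
    \<comment> \<open>Moving from y to \<open>y + t *\<^sub>R d\<close> adds t to each of the three
      products \<open>w s \<bullet> y\<close>, so at most three values of t make one of them
      vanish.\<close>
    obtain d where d: "\<forall>s\<in>{1..3}. w s \<bullet> d = 1"
      using invertible_cols3_inner_surj[of w "\<lambda>_. 1"] assms(8,11) by auto
    have "tensor_x2y2 A x y \<ge> 0" for x y
    \<comment> \<open>For fixed x the form is polynomial in t, so nonnegativity at good points
      \<open>y + t *\<^sub>R d\<close> with t near 0 passes to the limit y.\<close>
    proof (rule tendsto_lowerbound)
      have "isCont (\<lambda>t. tensor_x2y2 A x (y + t *\<^sub>R d)) 0"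
        unfolding tensor_x2y2_def by (intro continuous_intros)
      then show "((\<lambda>t. tensor_x2y2 A x (y + t *\<^sub>R d)) \<longlongrightarrow> tensor_x2y2 A x y) (at 0)"
        by (simp add: isCont_def)
      have "eventually (\<lambda>t. \<forall>s\<in>{1..3}. t \<noteq> - (w s \<bullet> y)) (at (0::real))"
        by (auto simp: eventually_ball_finite_distrib intro: eventually_neq_at_within)
      then show "\<forall>\<^sub>F t in at 0. 0 \<le> tensor_x2y2 A x (y + t *\<^sub>R d)"
      proof eventually_elim
        case (elim t)
        then have "good (y + t *\<^sub>R d)"
          using d by (auto simp: good_def inner_add_right)
        then show ?case
          by (rule nonneg)
      qed
    qed simp
    then show "M_PSD A"
      by (simp add: M_PSD_def)
  qed
qed

end
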